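(* Let $s>1$ and $t>1$ be integers and let $\alpha_{s,t}$ be the type-$\alpha$ comb with $s$ teeth of length $t$. Then no linear extension of $\alpha_{s,t}$ avoids the pattern $123$; i.e., the number of $123$-avoiding linear extensions of $\alpha_{s,t}$ is $0$.
   Context: A linear extension of a finite poset $P$ on a set of integers is a listing $v=[v_1,\dots,v_n]$ of all elements of $P$, each exactly once, such that whenever $a \leq_P b$, $a$ appears before $b$. For $w \in S_3$, a sequence $v$ of distinct integers contains $w$ if there are indices $i<j<k$ with $(v_i,v_j,v_k)$ in the same relative order as $(w_1,w_2,w_3)$; otherwise $v$ avoids $w$. The type-$\alpha$ comb $\alpha_{s,t}$ is the poset on $\{1,\dots,st\}$ whose order is generated by the relations $i \leq i+1$ for $1 \leq i \leq s-1$ (the spine $1,\dots,s$) and $x \leq x+s$ for $1 \leq x \leq (t-1)s$ (so the teeth are $c, c+s, \dots, c+(t-1)s$ for $1\le c\le s$). *)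

theory Defs
  imports Main
begin

text \<open>A finite poset is given by its ground set \<open>A\<close> and its order relation \<open>r\<close>, with
  \<open>(a, b) \<in> r\<close> meaning that \<open>a\<close> is less than or equal to \<open>b\<close> in the poset. List
  positions are counted from 0.\<close>

text \<open>The relation contains the pairs \<open>(a, a)\<close>, hence \<open>i \<le> j\<close> below; for distinct
  elements this amounts to \<open>i < j\<close>.\<close>

definition linear_extension :: "'a set \<Rightarrow> 'a rel \<Rightarrow> 'a list \<Rightarrow> bool" where
  "linear_extension A r v \<longleftrightarrow>
     distinct v \<and> set v = A \<and>
     (\<forall>i<length v. \<forall>j<length v. (v ! i, v ! j) \<in> r \<longrightarrow> i \<le> j)"

definition same_relative_order :: "'a::linorder list \<Rightarrow> 'b::linorder list \<Rightarrow> bool" where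
  "same_relative_order x y \<longleftrightarrow>
     length x = length y \<and>
     (\<forall>p<length x. \<forall>q<length x. x ! p < x ! q \<longleftrightarrow> y ! p < y ! q)"

text \<open>Patterns \<open>w\<close> are permutations of \<open>{1, 2, 3}\<close> in one-line notation, such as
  \<open>[1, 2, 3]\<close>.\<close>

definition contains_pattern :: "'a::linorder list \<Rightarrow> nat list \<Rightarrow> bool" where
  "contains_pattern v w \<longleftrightarrow>
     (\<exists>i j k. i < j \<and> j < k \<and> k < length v \<and> same_relative_order [v ! i, v ! j, v ! k] w)"

abbreviation avoids_pattern :: "'a::linorder list \<Rightarrow> nat list \<Rightarrow> bool" where
  "avoids_pattern v w \<equiv> \<not> contains_pattern v w"

definition comb_carrier :: "nat \<Rightarrow> nat \<Rightarrow> nat set" where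
  "comb_carrier s t = {1..s * t}"

definition alpha_comb_gen :: "nat \<Rightarrow> nat \<Rightarrow> nat rel" where
  "alpha_comb_gen s t =
     {(i, i + 1) | i. 1 \<le> i \<and> i \<le> s - 1} \<union> {(x, x + s) | x. 1 \<le> x \<and> x \<le> (t - 1) * s}"

text \<open>The closure is restricted to the ground set because \<^term>\<open>rtrancl\<close> is reflexive on
  the whole type.\<close>

definition alpha_comb :: "nat \<Rightarrow> nat \<Rightarrow> nat rel" where
  "alpha_comb s t = (alpha_comb_gen s t)\<^sup>* \<inter> comb_carrier s t \<times> comb_carrier s t"

lemma alpha_comb_gen_subset:
  assumes "t > 0"
  shows "alpha_comb_gen s t \<subseteq> comb_carrier s t \<times> comb_carrier s t"
proof -
  obtain u where t: "t = Suc u" using assms by (cases t) auto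
  show ?thesis
    unfolding alpha_comb_gen_def comb_carrier_def t by (auto simp: algebra_simps)
qed

lemma alpha_comb_le: "(a, b) \<in> alpha_comb s t \<Longrightarrow> a \<le> b"
proof -
  have "(a, b) \<in> (alpha_comb_gen s t)\<^sup>* \<Longrightarrow> a \<le> b"
    by (induction rule: rtrancl_induct) (auto simp: alpha_comb_gen_def)
  then show "(a, b) \<in> alpha_comb s t \<Longrightarrow> a \<le> b" by (simp add: alpha_comb_def)
qed

lemma partial_order_on_alpha_comb: "partial_order_on (comb_carrier s t) (alpha_comb s t)"
proof -
  have "refl_on (comb_carrier s t) (alpha_comb s t)"
    by (auto simp: refl_on_def alpha_comb_def)
  moreover have "trans (alpha_comb s t)"
    by (auto simp: trans_def alpha_comb_def)
  moreover have "antisym (alpha_comb s t)"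
    by (meson antisymI alpha_comb_le order_antisym)
  ultimately show ?thesis
    by (auto simp: partial_order_on_def preorder_on_def alpha_comb_def)
qed

lemma linear_extension_upt: "linear_extension (comb_carrier s t) (alpha_comb s t) [1..<s * t + 1]"
  by (auto simp: linear_extension_def comb_carrier_def simp del: upt_Suc dest: alpha_comb_le)

lemma finite_linear_extensions:
  assumes "finite A"
  shows "finite {v. linear_extension A r v}"
  by (rule finite_subset[OF _ finite_subset_distinct[OF assms]]) (auto simp: linear_extension_def)

end

theory Submission
  imports Defs
begin

text \<open>A chain of three poset elements that also increases as integers keeps its order in every
  linear extension, so it is an occurrence of 123. The comb has one: \<open>1\<close> to
  \<open>2\<close> is a spine step, as s > 1, and \<open>2\<close> to \<open>2 + s\<close> a tooth
  step, as t > 1.\<close>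

text \<open>Every linear extension lists the chain \<open>1, 2, s + 2\<close> of the comb in this order, and this
  chain is increasing as a sequence of integers.\<close>

lemma linear_extension_contains_123:
  assumes v: "linear_extension A r v"
    and r: "(a, b) \<in> r" "(b, c) \<in> r"
    and A: "a \<in> A" "b \<in> A" "c \<in> A"
    and less: "a < b" "b < c"
  shows "contains_pattern v [1, 2, 3]"
proof -
  have "set v = A" and mono: "\<And>i j. i < length v \<Longrightarrow> j < length v \<Longrightarrow> (v ! i, v ! j) \<in> r \<Longrightarrow> i \<le> j"
    using v by (auto simp: linear_extension_def)
  then obtain i j k where i: "i < length v" "v ! i = a" and j: "j < length v" "v ! j = b"
    and k: "k < length v" "v ! k = c"
    using A by (metis in_set_conv_nth)
  have "i \<le> j" "j \<le> k"
    using mono i j k r by auto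
  \<comment> \<open>Linear extensions order positions only weakly; strictness comes from the
    distinct values there.\<close>
  moreover have "i \<noteq> j" "j \<noteq> k"
    using i j k less by auto
  moreover have "same_relative_order [v ! i, v ! j, v ! k] [1, 2, 3 :: nat]"
    using i j k less by (auto simp: same_relative_order_def less_Suc_eq)
  ultimately show ?thesis
    using k(1) unfolding contains_pattern_def by (metis le_neq_implies_less)
qed

lemma alpha_comb_genI:
  assumes "t > 0" and "(x, y) \<in> alpha_comb_gen s t"
  shows "(x, y) \<in> alpha_comb s t"
  using assms alpha_comb_gen_subset[of t s] by (auto simp: alpha_comb_def)

theorem theorem3:
  fixes s t :: nat
  assumes "s > 1" and "t > 1"
  shows "(\<forall>v. linear_extension (comb_carrier s t) (alpha_comb s t) v \<longrightarrow>
            \<not> avoids_pattern v [1, 2, 3]) \<and>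
         card {v. linear_extension (comb_carrier s t) (alpha_comb s t) v \<and>
                  avoids_pattern v [1, 2, 3]} = 0"
proof -
  \<comment> \<open>This is the bound that lets \<open>x = 2\<close> start a tooth step.\<close>
  have "1 * 2 \<le> (t - 1) * s"
    using assms by (intro mult_le_mono) auto
  then have gen: "(1, 2) \<in> alpha_comb_gen s t" "(2, 2 + s) \<in> alpha_comb_gen s t"
    using assms by (auto simp: alpha_comb_gen_def)
  then have rel: "(1, 2) \<in> alpha_comb s t" "(2, 2 + s) \<in> alpha_comb s t"
    using assms alpha_comb_genI by auto
  then have carrier: "1 \<in> comb_carrier s t" "2 \<in> comb_carrier s t" "2 + s \<in> comb_carrier s t"
    by (auto simp: alpha_comb_def)
  have "contains_pattern v [1, 2, 3]"
    if "linear_extension (comb_carrier s t) (alpha_comb s t) v" for v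
    using linear_extension_contains_123[OF that rel carrier] assms by simp
  \<comment> \<open>The set counted is empty, so its \<open>card\<close> of 0 is a true count, not
    the default for infinite sets.\<close>
  then show ?thesis
    by (auto simp: card_eq_0_iff)
qed

end
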